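(* Let $(\tilde{\mathbf R}^*(\mathbf J),\mathbf W^*(\mathbf J))_{\mathbf J\in\mathcal J}$ be an optimal solution of problem (P) described in the context, and let $\boldsymbol\lambda^{R*}$ be the vector of optimal Lagrange multipliers of the average rate constraints of (P). Then for every $\mathbf J\in\mathcal J$, every user $m$ and every channel $k$, the optimum rate allocation is given by: (i) $[\tilde{\mathbf R}^*(\mathbf J)]_{m,k}=0$, if either $[\mathbf W^*(\mathbf J)]_{m,k}=0$ or $$\frac{[\boldsymbol\lambda^{R*}]_m}{[\boldsymbol\mu]_m}<\dot\Upsilon_{\mathcal R([\mathbf J]_{m,k})}\left(\frac{[\tilde{\mathbf R}^*(\mathbf J)]_{m,k}}{[\mathbf W^*(\mathbf J)]_{m,k}}\right);$$ (ii) otherwise, $$[\tilde{\mathbf R}^*(\mathbf J)]_{m,k}=\dot\Upsilon^{-1}_{\mathcal R([\mathbf J]_{m,k})}\left(\frac{[\boldsymbol\lambda^{R*}]_m}{[\boldsymbol\mu]_m}\right)[\mathbf W^*(\mathbf J)]_{m,k}.$$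
   Context: There are $M$ users ($m=1,\dots,M$) and $K$ orthogonal channels ($k=1,\dots,K$). The quantized channel state is a random $M\times K$ matrix $\mathbf J$ taking values in a finite set $\mathcal J$ with probability mass function $\Pr\{\mathbf J\}>0$; the entry $[\mathbf J]_{m,k}$ is the index of the quantization region $\mathcal R([\mathbf J]_{m,k})$ in which the gain of user $m$ on channel $k$ falls. For each region there is a power-rate function $\Upsilon_{\mathcal R([\mathbf J]_{m,k})}$ (power needed as a function of the rate $x\ge 0$). Standing assumption: each $\Upsilon_{\mathcal R([\mathbf J]_{m,k})}$ is increasing and strictly convex; it is differentiable, $\dot\Upsilon$ denotes its derivative and $\dot\Upsilon^{-1}$ the inverse function of $\dot\Upsilon$. The vector $\boldsymbol\mu\in\mathbb R^M$ collects user weights ($[\boldsymbol\mu]_m>0$) and $\check{\mathbf r}\in\mathbb R^M$ collects minimum average rate requirements. Problem (P): over matrices $\tilde{\mathbf R}(\mathbf J)\ge 0$, $\mathbf W(\mathbf J)\ge 0$ (of size $M\times K$, entrywise nonnegative, one pair for each $\mathbf J\in\mathcal J$), $$\min\ \sum_{\mathbf J\in\mathcal J}\left(\sum_{m=1}^M[\boldsymbol\mu]_m\sum_{k=1}^K\Upsilon_{\mathcal R([\mathbf J]_{m,k})}\left(\frac{[\tilde{\mathbf R}(\mathbf J)]_{m,k}}{[\mathbf W(\mathbf J)]_{m,k}}\right)[\mathbf W(\mathbf J)]_{m,k}\right)\Pr\{\mathbf J\}$$ subject to $$\sum_{\mathbf J\in\mathcal J}\left(\sum_{k=1}^K[\tilde{\mathbf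 R}(\mathbf J)]_{m,k}\right)\Pr\{\mathbf J\}\ge[\check{\mathbf r}]_m\ \ \forall m,\qquad \sum_{m=1}^M[\mathbf W(\mathbf J)]_{m,k}\le 1\ \ \forall k,\ \forall\mathbf J .$$ Here $[\mathbf W(\mathbf J)]_{m,k}$ is the fraction of channel $k$ scheduled for user $m$, and $[\tilde{\mathbf R}(\mathbf J)]_{m,k}:=[\mathbf R(\mathbf J)]_{m,k}[\mathbf W(\mathbf J)]_{m,k}$ where $[\mathbf R(\mathbf J)]_{m,k}\ge0$ is the nominal rate; in particular $[\mathbf W(\mathbf J)]_{m,k}=0$ forces $[\tilde{\mathbf R}(\mathbf J)]_{m,k}=0$ and the corresponding cost term is $0$. Problem (P) is convex and assumed strictly feasible, so that the Karush-Kuhn-Tucker (KKT) conditions are necessary and sufficient for optimality. $[\boldsymbol\lambda^{R*}]_m\ge 0$ is the optimal KKT multiplier of the $m$th average rate constraint, in the sign convention in which the Lagrangian contains the term $-[\boldsymbol\lambda^{R}]_m\big(\sum_{\mathbf J}\sum_k[\tilde{\mathbf R}(\mathbf J)]_{m,k}\Pr\{\mathbf J\}-[\check{\mathbf r}]_m\big)$. *)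

theory Defs
  imports "HOL-Analysis.Analysis" "HOL-Probability.Probability_Mass_Function"
begin

text \<open>
  Users are the elements of the finite type \<open>'m\<close>, channels those of the finite type \<open>'k\<close>, and
  \<open>'q\<close> is the type of indices of quantization regions.  The random channel state is a pmf \<open>p\<close> on
  \<open>M \<times> K\<close> matrices of region indices; the finite set of channel states is \<open>set_pmf p\<close>, on which
  \<open>pmf p J > 0\<close>.  \<open>U i\<close> is the power-rate function of the region with index \<open>i\<close>; only its values
  on \<open>{0..}\<close> are meaningful.
\<close>

type_synonym ('q, 'k, 'm) csi = "'q ^ 'k ^ 'm"
type_synonym ('q, 'k, 'm) alloc = "('q, 'k, 'm) csi \<Rightarrow> real ^ 'k ^ 'm"

definition strictly_convex_on :: "'a::real_vector set \<Rightarrow> ('a \<Rightarrow> real) \<Rightarrow> bool" where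
  "strictly_convex_on S f \<longleftrightarrow> convex S \<and>
     (\<forall>x\<in>S. \<forall>y\<in>S. \<forall>u>0. \<forall>v>0. x \<noteq> y \<longrightarrow> u + v = 1 \<longrightarrow>
        f (u *\<^sub>R x + v *\<^sub>R y) < u * f x + v * f y)"

definition power_rate_function :: "(real \<Rightarrow> real) \<Rightarrow> bool" where
  "power_rate_function f \<longleftrightarrow>
     strict_mono_on {0..} f \<and> strictly_convex_on {0..} f \<and> f differentiable_on {0..}"

text \<open>The derivative on \<open>{0..}\<close>; at \<open>0\<close> it is the right derivative.\<close>

definition rate_deriv :: "(real \<Rightarrow> real) \<Rightarrow> real \<Rightarrow> real" where
  "rate_deriv f x = vector_derivative f (at x within {0..})"

text \<open>
  The inverse function of the derivative, defined on \<open>rate_deriv f ` {0..}\<close> and with values in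
  \<open>{0..}\<close>; it carries no information outside that image.
\<close>

definition rate_deriv_inv :: "(real \<Rightarrow> real) \<Rightarrow> real \<Rightarrow> real" where
  "rate_deriv_inv f = inv_into {0..} (rate_deriv f)"

text \<open>
  The average weighted power.  A term with \<open>W J $ m $ k = 0\<close> vanishes, whatever the value of the
  quotient.
\<close>

definition avg_power ::
  "('q, 'k::finite, 'm::finite) csi pmf \<Rightarrow> ('q \<Rightarrow> real \<Rightarrow> real) \<Rightarrow> real ^ 'm \<Rightarrow>
   ('q, 'k, 'm) alloc \<Rightarrow> ('q, 'k, 'm) alloc \<Rightarrow> real" where
  "avg_power p U \<mu> R W =
     (\<Sum>J\<in>set_pmf p. (\<Sum>m\<in>UNIV. \<mu> $ m *
        (\<Sum>k\<in>UNIV. U (J $ m $ k) (R J $ m $ k / W J $ m $ k) * W J $ m $ k)) * pmf p J)"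

definition avg_rate ::
  "('q, 'k::finite, 'm::finite) csi pmf \<Rightarrow> ('q, 'k, 'm) alloc \<Rightarrow> 'm \<Rightarrow> real" where
  "avg_rate p R m = (\<Sum>J\<in>set_pmf p. (\<Sum>k\<in>UNIV. R J $ m $ k) * pmf p J)"

text \<open>
  The set over which the problem is posed.  Since the variable \<open>R\<close> stands for the product of the
  nominal rate and the scheduled fraction, it vanishes where nothing is scheduled.
\<close>

definition admissible ::
  "('q, 'k::finite, 'm::finite) csi pmf \<Rightarrow> ('q, 'k, 'm) alloc \<Rightarrow> ('q, 'k, 'm) alloc \<Rightarrow> bool" where
  "admissible p R W \<longleftrightarrow>
     (\<forall>J\<in>set_pmf p. \<forall>m k. 0 \<le> R J $ m $ k \<and> 0 \<le> W J $ m $ k \<and>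
        (W J $ m $ k = 0 \<longrightarrow> R J $ m $ k = 0))"

definition feasible ::
  "('q, 'k::finite, 'm::finite) csi pmf \<Rightarrow> real ^ 'm \<Rightarrow>
   ('q, 'k, 'm) alloc \<Rightarrow> ('q, 'k, 'm) alloc \<Rightarrow> bool" where
  "feasible p r R W \<longleftrightarrow> admissible p R W \<and>
     (\<forall>m. r $ m \<le> avg_rate p R m) \<and>
     (\<forall>J\<in>set_pmf p. \<forall>k. (\<Sum>m\<in>UNIV. W J $ m $ k) \<le> 1)"

definition strictly_feasible ::
  "('q, 'k::finite, 'm::finite) csi pmf \<Rightarrow> real ^ 'm \<Rightarrow> bool" where
  "strictly_feasible p r \<longleftrightarrow> (\<exists>R W :: ('q, 'k, 'm) alloc.
     (\<forall>J\<in>set_pmf p. \<forall>m k. 0 < R J $ m $ k \<and> 0 < W J $ m $ k) \<and>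
     (\<forall>m. r $ m < avg_rate p R m) \<and>
     (\<forall>J\<in>set_pmf p. \<forall>k. (\<Sum>m\<in>UNIV. W J $ m $ k) < 1))"

definition optimal ::
  "('q, 'k::finite, 'm::finite) csi pmf \<Rightarrow> ('q \<Rightarrow> real \<Rightarrow> real) \<Rightarrow> real ^ 'm \<Rightarrow> real ^ 'm \<Rightarrow>
   ('q, 'k, 'm) alloc \<Rightarrow> ('q, 'k, 'm) alloc \<Rightarrow> bool" where
  "optimal p U \<mu> r R W \<longleftrightarrow> feasible p r R W \<and>
     (\<forall>R' W'. feasible p r R' W' \<longrightarrow> avg_power p U \<mu> R W \<le> avg_power p U \<mu> R' W')"

definition lagrangian ::
  "('q, 'k::finite, 'm::finite) csi pmf \<Rightarrow> ('q \<Rightarrow> real \<Rightarrow> real) \<Rightarrow> real ^ 'm \<Rightarrow> real ^ 'm \<Rightarrow>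
   real ^ 'm \<Rightarrow> (('q, 'k, 'm) csi \<Rightarrow> real ^ 'k) \<Rightarrow>
   ('q, 'k, 'm) alloc \<Rightarrow> ('q, 'k, 'm) alloc \<Rightarrow> real" where
  "lagrangian p U \<mu> r lamR lamW R W =
     avg_power p U \<mu> R W
     - (\<Sum>m\<in>UNIV. lamR $ m * (avg_rate p R m - r $ m))
     + (\<Sum>J\<in>set_pmf p. \<Sum>k\<in>UNIV. lamW J $ k * ((\<Sum>m\<in>UNIV. W J $ m $ k) - 1))"

text \<open>
  The KKT conditions of the convex problem.  The objective is not differentiable where
  \<open>W J $ m $ k = 0\<close>, so stationarity takes the subdifferential form: zero is a subgradient at
  \<open>(R, W)\<close> of the Lagrangian restricted to the admissible set (the nonnegativity constraints are
  kept as set constraints).  Unfolded, this is the last conjunct.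
\<close>

definition kkt_conditions ::
  "('q, 'k::finite, 'm::finite) csi pmf \<Rightarrow> ('q \<Rightarrow> real \<Rightarrow> real) \<Rightarrow> real ^ 'm \<Rightarrow> real ^ 'm \<Rightarrow>
   ('q, 'k, 'm) alloc \<Rightarrow> ('q, 'k, 'm) alloc \<Rightarrow>
   real ^ 'm \<Rightarrow> (('q, 'k, 'm) csi \<Rightarrow> real ^ 'k) \<Rightarrow> bool" where
  "kkt_conditions p U \<mu> r R W lamR lamW \<longleftrightarrow>
     feasible p r R W \<and>
     (\<forall>m. 0 \<le> lamR $ m) \<and> (\<forall>J\<in>set_pmf p. \<forall>k. 0 \<le> lamW J $ k) \<and>
     (\<forall>m. lamR $ m * (avg_rate p R m - r $ m) = 0) \<and>
     (\<forall>J\<in>set_pmf p. \<forall>k. lamW J $ k * ((\<Sum>m\<in>UNIV. W J $ m $ k) - 1) = 0) \<and>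
     (\<forall>R' W'. admissible p R' W' \<longrightarrow>
        lagrangian p U \<mu> r lamR lamW R W \<le> lagrangian p U \<mu> r lamR lamW R' W')"

definition optimal_rate_multipliers ::
  "('q, 'k::finite, 'm::finite) csi pmf \<Rightarrow> ('q \<Rightarrow> real \<Rightarrow> real) \<Rightarrow> real ^ 'm \<Rightarrow> real ^ 'm \<Rightarrow>
   ('q, 'k, 'm) alloc \<Rightarrow> ('q, 'k, 'm) alloc \<Rightarrow> real ^ 'm \<Rightarrow> bool" where
  "optimal_rate_multipliers p U \<mu> r R W lamR \<longleftrightarrow>
     (\<exists>lamW. kkt_conditions p U \<mu> r R W lamR lamW)"

end

theory Submission
  imports Defs
begin

text \<open>
  Changing a single entry of \<open>R\<close> to \<open>t * W J $ m $ k\<close> preserves admissibility and changes the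
  Lagrangian by \<open>W J $ m $ k * pmf p J\<close> times the change of \<open>\<mu> $ m * U (J $ m $ k) t - lamR $ m * t\<close>.
  Hence the nominal rate minimizes this function over \<open>{0..}\<close>, and the first-order condition at
  the minimizer is the claim; strict convexity makes the derivative injective.
\<close>

text \<open>Chain rule along the segment from \<open>x\<close> to \<open>y\<close>, which convexity
  keeps inside \<open>S\<close>. The limit is one-sided, so a boundary point such as rate zero is
  treated like an interior one.\<close>

lemma tendsto_slope_along_segment:
  fixes f :: "real \<Rightarrow> real"
  assumes f: "(f has_real_derivative D) (at x within S)"
    and S: "convex S" "x \<in> S" "y \<in> S"
  shows "((\<lambda>u. (f (x + u * (y - x)) - f x) / u) \<longlongrightarrow> D * (y - x)) (at_right 0)"
proof -
  let ?l = "\<lambda>u. x + u * (y - x)"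
  have img: "?l ` {0..1} \<subseteq> S"
  proof clarify
    fix u :: real assume "u \<in> {0..1}"
    then have "(1 - u) *\<^sub>R x + u *\<^sub>R y \<in> S"
      using S by (intro convexD) auto
    then show "?l u \<in> S" by (simp add: algebra_simps)
  qed
  have l: "(?l has_real_derivative (y - x)) (at 0 within {0..1})"
    by (auto intro!: derivative_eq_intros)
  have "(f has_real_derivative D) (at (?l 0) within ?l ` {0..1})"
    using DERIV_subset[OF f img] by simp
  from DERIV_image_chain[OF this l]
  have "((\<lambda>u. f (?l u)) has_real_derivative D * (y - x)) (at 0 within {0..1})"
    by (simp add: o_def)
  then have "((\<lambda>u. (f (?l u) - f x) / u) \<longlongrightarrow> D * (y - x)) (at 0 within {0..1})"
    by (simp add: has_field_derivative_iff)
  moreover have "at (0::real) within {0..1} = at_right 0"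
    by (rule at_within_Icc_at_right) simp
  ultimately show ?thesis by simp
qed

text \<open>The difference quotients towards \<open>y\<close> are nonnegative at a minimizer, hence
  so is their limit. The variational form covers interior and boundary minimizers at once, by the
  choice of \<open>y\<close>.\<close>

lemma minimizer_first_order:
  fixes f :: "real \<Rightarrow> real"
  assumes f: "(f has_real_derivative D) (at x within S)"
    and S: "convex S" "x \<in> S" "y \<in> S"
    and min: "\<And>z. z \<in> S \<Longrightarrow> f x \<le> f z"
  shows "0 \<le> D * (y - x)"
proof (rule tendsto_lowerbound[OF tendsto_slope_along_segment[OF f S]])
  have "0 \<le> (f (x + u * (y - x)) - f x) / u" if "0 < u" "u < 1" for u
  proof -
    have "(1 - u) *\<^sub>R x + u *\<^sub>R y \<in> S"
      using S that by (intro convexD) auto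
    then have "x + u * (y - x) \<in> S" by (simp add: algebra_simps)
    from min[OF this] that show ?thesis by simp
  qed
  then show "\<forall>\<^sub>F u in at_right 0. 0 \<le> (f (x + u * (y - x)) - f x) / u"
    using eventually_at_right_real[of 0 1] by (auto elim!: eventually_mono)
qed simp

lemma strictly_convex_on_above_tangent:
  fixes f :: "real \<Rightarrow> real"
  assumes conv: "strictly_convex_on S f"
    and f: "(f has_real_derivative D) (at x within S)"
    and xy: "x \<in> S" "y \<in> S" "x \<noteq> y"
  shows "f x + D * (y - x) < f y"
proof -
  have S: "convex S" using conv by (simp add: strictly_convex_on_def)
  have chord: "f (x + u * (z - x)) < f x + u * (f z - f x)"
    if "0 < u" "u < 1" "z \<in> S" "x \<noteq> z" for u z
  proof -
    have "f ((1 - u) *\<^sub>R x + u *\<^sub>R z) < (1 - u) * f x + u * f z"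
      using conv that xy unfolding strictly_convex_on_def by auto
    then show ?thesis by (simp add: algebra_simps)
  qed
  \<comment> \<open>Passing to the limit in the chord inequality leaves only a weak bound. It is
    therefore used at the midpoint \<open>z\<close>, and the strict chord inequality between
    \<open>x\<close> and \<open>y\<close> at \<open>z\<close> restores strictness.\<close>
  define z where "z = x + (1/2) * (y - x)"
  have "(1/2) *\<^sub>R x + (1/2) *\<^sub>R y \<in> S"
    using S xy by (intro convexD) auto
  moreover have "z = (1/2) *\<^sub>R x + (1/2) *\<^sub>R y"
    by (simp add: z_def field_simps)
  ultimately have zS: "z \<in> S" by simp
  have zx: "x \<noteq> z" using xy by (simp add: z_def)
  have "D * (z - x) \<le> f z - f x"
  proof (rule tendsto_upperbound[OF tendsto_slope_along_segment[OF f S xy(1) zS]])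
    have "(f (x + u * (z - x)) - f x) / u \<le> f z - f x" if "0 < u" "u < 1" for u
      using chord[OF that zS zx] that by (simp add: divide_le_eq mult.commute)
    then show "\<forall>\<^sub>F u in at_right 0. (f (x + u * (z - x)) - f x) / u \<le> f z - f x"
      using eventually_at_right_real[of 0 1] by (auto elim!: eventually_mono)
  qed simp
  moreover have "f z < f x + (1/2) * (f y - f x)"
    unfolding z_def using xy by (intro chord) auto
  moreover have "D * (z - x) = (1/2) * (D * (y - x))"
    by (simp add: z_def)
  ultimately show ?thesis by argo
qed

lemma power_rate_function_has_derivative:
  assumes "power_rate_function f" "0 \<le> x"
  shows "(f has_real_derivative rate_deriv f x) (at x within {0..})"
proof -
  have "f differentiable (at x within {0..})"
    using assms by (auto simp: power_rate_function_def differentiable_on_def)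
  then show ?thesis
    unfolding rate_deriv_def has_real_derivative_iff_has_vector_derivative
    by (simp add: vector_derivative_works)
qed

text \<open>If two distinct points had the same slope, the strict tangent inequalities at both would
  add up to a contradiction. Thus \<open>rate_deriv_inv\<close> is a genuine inverse on the image of
  the derivative.\<close>

lemma inj_on_rate_deriv:
  assumes "power_rate_function f"
  shows "inj_on (rate_deriv f) {0..}"
proof (rule inj_onI, rule ccontr)
  fix x y :: real
  assume xy: "x \<in> {0..}" "y \<in> {0..}" and eq: "rate_deriv f x = rate_deriv f y" and "x \<noteq> y"
  have "strictly_convex_on {0..} f"
    using assms by (simp add: power_rate_function_def)
  note tangent = strictly_convex_on_above_tangent
    [OF this power_rate_function_has_derivative[OF assms]]
  have "f x + rate_deriv f x * (y - x) < f y" "f y + rate_deriv f y * (x - y) < f x"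
    using xy \<open>x \<noteq> y\<close> by (auto intro!: tangent)
  then show False by (simp add: eq algebra_simps)
qed

definition update_entry ::
  "('q, 'k::finite, 'm::finite) csi \<Rightarrow> 'm \<Rightarrow> 'k \<Rightarrow> real \<Rightarrow> ('q, 'k, 'm) alloc \<Rightarrow> ('q, 'k, 'm) alloc"
  where "update_entry J m k x R =
    R(J := (\<chi> i j. if i = m \<and> j = k then x else R J $ i $ j))"

lemma update_entry_nth:
  "update_entry J m k x R J' $ i $ j =
     (if J' = J \<and> i = m \<and> j = k then x else R J' $ i $ j)"
  by (simp add: update_entry_def)

text \<open>The function \<open>h\<close> may depend on the channel, so that one identity serves
  both the rate (\<open>h\<close> the identity in its second argument) and the power cost of a
  channel.\<close>

lemma sum_channels_update_entry:
  fixes R :: "('q, 'k::finite, 'm::finite) alloc" and h :: "'k \<Rightarrow> real \<Rightarrow> real"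
  shows "(\<Sum>j\<in>UNIV. h j (update_entry J m k x R J' $ i $ j)) =
    (\<Sum>j\<in>UNIV. h j (R J' $ i $ j)) +
      (if J' = J \<and> i = m then h k x - h k (R J $ m $ k) else 0)"
proof -
  have "(\<Sum>j\<in>UNIV. h j (update_entry J m k x R J' $ i $ j)) =
    (\<Sum>j\<in>UNIV. h j (R J' $ i $ j) +
      (if j = k then if J' = J \<and> i = m then h k x - h k (R J $ m $ k) else 0 else 0))"
    by (intro sum.cong) (auto simp: update_entry_nth)
  also have "\<dots> = (\<Sum>j\<in>UNIV. h j (R J' $ i $ j)) +
      (if J' = J \<and> i = m then h k x - h k (R J $ m $ k) else 0)"
    by (simp add: sum.distrib)
  finally show ?thesis .
qed

lemma avg_rate_update_entry:
  assumes "finite (set_pmf p)" "J \<in> set_pmf p"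
  shows "avg_rate p (update_entry J m k x R) i =
    avg_rate p R i + (if i = m then (x - R J $ m $ k) * pmf p J else 0)"
proof -
  have "avg_rate p (update_entry J m k x R) i =
    (\<Sum>J'\<in>set_pmf p. (\<Sum>j\<in>UNIV. R J' $ i $ j) * pmf p J' +
      (if J' = J then if i = m then (x - R J $ m $ k) * pmf p J else 0 else 0))"
    unfolding avg_rate_def sum_channels_update_entry[where h = "\<lambda>_ t. t"]
    by (intro sum.cong) (auto simp: algebra_simps)
  then show ?thesis using assms by (simp add: sum.distrib avg_rate_def)
qed

lemma avg_power_update_entry:
  assumes "finite (set_pmf p)" "J \<in> set_pmf p"
  shows "avg_power p U \<mu> (update_entry J m k x R) W =
    avg_power p U \<mu> R W +
      \<mu> $ m * ((U (J $ m $ k) (x / W J $ m $ k) - U (J $ m $ k) (R J $ m $ k / W J $ m $ k))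
        * W J $ m $ k) * pmf p J"
proof -
  let ?d = "(U (J $ m $ k) (x / W J $ m $ k) - U (J $ m $ k) (R J $ m $ k / W J $ m $ k))
    * W J $ m $ k"
  let ?S = "\<lambda>R J' i. \<Sum>j\<in>UNIV. U (J' $ i $ j) (R J' $ i $ j / W J' $ i $ j) * W J' $ i $ j"
  have users: "(\<Sum>i\<in>UNIV. \<mu> $ i * ?S (update_entry J m k x R) J' i) =
    (\<Sum>i\<in>UNIV. \<mu> $ i * ?S R J' i) + (if J' = J then \<mu> $ m * ?d else 0)" for J'
  proof -
    have "(\<Sum>i\<in>UNIV. \<mu> $ i * ?S (update_entry J m k x R) J' i) =
      (\<Sum>i\<in>UNIV. \<mu> $ i * ?S R J' i + (if i = m then if J' = J then \<mu> $ m * ?d else 0 else 0))"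
      unfolding sum_channels_update_entry
        [where h = "\<lambda>j t. U (J' $ i $ j) (t / W J' $ i $ j) * W J' $ i $ j" for i]
      by (intro sum.cong) (auto simp: algebra_simps)
    then show ?thesis by (simp add: sum.distrib)
  qed
  have "avg_power p U \<mu> (update_entry J m k x R) W =
    (\<Sum>J'\<in>set_pmf p. (\<Sum>i\<in>UNIV. \<mu> $ i * ?S R J' i) * pmf p J' +
      (if J' = J then \<mu> $ m * ?d * pmf p J else 0))"
    unfolding avg_power_def users by (intro sum.cong) (auto simp: distrib_right)
  then show ?thesis using assms by (simp add: sum.distrib avg_power_def)
qed

text \<open>The term with \<open>lamW\<close> involves only \<open>W\<close> and cancels, which
  leaves the changes of power and rate.\<close>

lemma lagrangian_update_entry:
  assumes "finite (set_pmf p)" "J \<in> set_pmf p"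
  shows "lagrangian p U \<mu> r lamR lamW (update_entry J m k x R) W =
    lagrangian p U \<mu> r lamR lamW R W +
      (\<mu> $ m * ((U (J $ m $ k) (x / W J $ m $ k) - U (J $ m $ k) (R J $ m $ k / W J $ m $ k))
        * W J $ m $ k) - lamR $ m * (x - R J $ m $ k)) * pmf p J"
proof -
  have "(\<Sum>i\<in>UNIV. lamR $ i * (avg_rate p (update_entry J m k x R) i - r $ i)) =
    (\<Sum>i\<in>UNIV. lamR $ i * (avg_rate p R i - r $ i) +
      (if i = m then lamR $ m * (x - R J $ m $ k) * pmf p J else 0))"
    unfolding avg_rate_update_entry[OF assms] by (intro sum.cong) (auto simp: algebra_simps)
  also have "\<dots> = (\<Sum>i\<in>UNIV. lamR $ i * (avg_rate p R i - r $ i)) +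
      lamR $ m * (x - R J $ m $ k) * pmf p J"
    by (simp add: sum.distrib)
  finally show ?thesis
    unfolding lagrangian_def avg_power_update_entry[OF assms] left_diff_distrib by simp
qed

lemma kkt_nominal_rate_minimizes:
  fixes p :: "('q, 'k::finite, 'm::finite) csi pmf"
  assumes fin: "finite (set_pmf p)" and J: "J \<in> set_pmf p"
    and kkt: "kkt_conditions p U \<mu> r R W lamR lamW"
    and W: "W J $ m $ k \<noteq> 0" and t: "0 \<le> t"
  shows "\<mu> $ m * U (J $ m $ k) (R J $ m $ k / W J $ m $ k)
      - lamR $ m * (R J $ m $ k / W J $ m $ k)
    \<le> \<mu> $ m * U (J $ m $ k) t - lamR $ m * t" (is "?a \<le> ?b")
proof -
  let ?w = "W J $ m $ k"
  \<comment> \<open>With \<open>W\<close> kept fixed, this competitor has nominal rate exactly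
    \<open>t\<close> at the chosen entry. It stays admissible because \<open>?w\<close> is positive
    there.\<close>
  let ?R = "update_entry J m k (t * ?w) R"
  have adm: "admissible p R W"
    using kkt by (simp add: kkt_conditions_def feasible_def)
  then have w: "0 < ?w" using J W by (auto simp: admissible_def less_le)
  have "admissible p ?R W"
    using adm w t by (auto simp: admissible_def update_entry_nth)
  then have "lagrangian p U \<mu> r lamR lamW R W \<le> lagrangian p U \<mu> r lamR lamW ?R W"
    using kkt by (simp add: kkt_conditions_def)
  then have "0 \<le> (\<mu> $ m * ((U (J $ m $ k) t - U (J $ m $ k) (R J $ m $ k / ?w)) * ?w)
      - lamR $ m * (t * ?w - R J $ m $ k)) * pmf p J"
    using w by (simp add: lagrangian_update_entry[OF fin J])
  moreover have "0 < pmf p J" using J by (rule pmf_positive)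
  ultimately have "0 \<le> \<mu> $ m * ((U (J $ m $ k) t - U (J $ m $ k) (R J $ m $ k / ?w)) * ?w)
      - lamR $ m * (t * ?w - R J $ m $ k)"
    by (simp add: zero_le_mult_iff)
  \<comment> \<open>Both the power and the rate change are proportional to the scheduled fraction,
    which can then be cancelled.\<close>
  also have "\<dots> = (?b - ?a) * ?w"
    using w by (simp add: field_simps)
  finally show ?thesis using w by (simp add: zero_le_mult_iff)
qed

theorem proposition1:
  fixes p :: "('q, 'k::finite, 'm::finite) csi pmf"
    and U :: "'q \<Rightarrow> real \<Rightarrow> real"
    and \<mu> r lamR :: "real ^ 'm"
    and R W :: "('q, 'k, 'm) alloc"
    and J :: "('q, 'k, 'm) csi" and m :: 'm and k :: 'k
  assumes "finite (set_pmf p)"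
    and "\<And>J m k. J \<in> set_pmf p \<Longrightarrow> power_rate_function (U (J $ m $ k))"
    and "\<And>m. 0 < \<mu> $ m"
    and "strictly_feasible p r"
    and "optimal p U \<mu> r R W"
    and "optimal_rate_multipliers p U \<mu> r R W lamR"
    and "J \<in> set_pmf p"
  shows "(W J $ m $ k = 0 \<or>
            lamR $ m / \<mu> $ m < rate_deriv (U (J $ m $ k)) (R J $ m $ k / W J $ m $ k)
          \<longrightarrow> R J $ m $ k = 0) \<and>
         (\<not> (W J $ m $ k = 0 \<or>
            lamR $ m / \<mu> $ m < rate_deriv (U (J $ m $ k)) (R J $ m $ k / W J $ m $ k))
          \<longrightarrow> lamR $ m / \<mu> $ m \<in> rate_deriv (U (J $ m $ k)) ` {0..} \<and>
              R J $ m $ k = rate_deriv_inv (U (J $ m $ k)) (lamR $ m / \<mu> $ m) * W J $ m $ k)"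
proof -
  let ?f = "U (J $ m $ k)" and ?w = "W J $ m $ k"
  let ?l = "lamR $ m / \<mu> $ m" and ?t = "R J $ m $ k / W J $ m $ k"
  obtain lamW where kkt: "kkt_conditions p U \<mu> r R W lamR lamW"
    using assms(6) by (auto simp: optimal_rate_multipliers_def)
  have adm: "0 \<le> R J $ m $ k" "0 \<le> ?w" "?w = 0 \<longrightarrow> R J $ m $ k = 0"
    using kkt assms(7) by (auto simp: kkt_conditions_def feasible_def admissible_def)
  have f: "power_rate_function ?f" using assms(2,7) .
  have \<mu>: "0 < \<mu> $ m" using assms(3) .
  show ?thesis
  proof (cases "?w = 0")
    \<comment> \<open>Admissibility gives the first claim and the second is vacuous, so the value of
      the quotient by zero is irrelevant.\<close>
    case True
    then show ?thesis using adm by simp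
  next
    case False
    with adm have w: "0 < ?w" by simp
    then have t: "0 \<le> ?t" using adm by simp
    let ?D = "\<mu> $ m * rate_deriv ?f ?t - lamR $ m"
    have "((\<lambda>s. \<mu> $ m * ?f s - lamR $ m * s) has_real_derivative ?D) (at ?t within {0..})"
      using power_rate_function_has_derivative[OF f t] by (auto intro!: derivative_eq_intros)
    then have first_order: "0 \<le> ?D * (y - ?t)" if "0 \<le> y" for y
      using kkt_nominal_rate_minimizes[OF assms(1,7) kkt False] t that
      by (intro minimizer_first_order[where S = "{0..}"]) auto
    \<comment> \<open>Increasing the nominal rate is always allowed, so the slope \<open>?D\<close>
      is nonnegative.\<close>
    have ge: "?l \<le> rate_deriv ?f ?t"
      using first_order[of "?t + 1"] t \<mu> by (simp add: divide_le_eq mult.commute)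
    \<comment> \<open>A strictly positive slope is compatible with minimality only at the boundary;
      the test direction is towards \<open>0\<close>.\<close>
    have zero_rate: "?t = 0" if "?l < rate_deriv ?f ?t"
    proof -
      have "0 < ?D" using that \<mu> by (simp add: divide_less_eq mult.commute)
      moreover have "?D * ?t \<le> 0" using first_order[of 0] by simp
      ultimately have "?t \<le> 0" by (meson mult_pos_pos not_le)
      with t show ?thesis by (rule order_antisym[rotated])
    qed
    \<comment> \<open>Only equality remains. It exhibits \<open>?l\<close> as a value of the
      derivative at \<open>?t\<close>, which puts it in the image where the inverse is
      meaningful.\<close>
    have "?l \<in> rate_deriv ?f ` {0..} \<and> R J $ m $ k = rate_deriv_inv ?f ?l * ?w"
      if "\<not> ?l < rate_deriv ?f ?t"
    proof -
      have eq: "?l = rate_deriv ?f ?t" using ge that by simp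
      have "rate_deriv_inv ?f (rate_deriv ?f ?t) = ?t"
        unfolding rate_deriv_inv_def using inj_on_rate_deriv[OF f] t by (intro inv_into_f_f) auto
      then show ?thesis unfolding eq using t w by simp
    qed
    then show ?thesis using zero_rate False by auto
  qed
qed

end
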